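(* Let $H(n)$ denote the Hurwitz class number. For every $\rho>1$ and every $\epsilon>0$, as $x\to\infty$, $$\frac1{\Gamma(\rho+1)}\sum_{n\le x}H(n)(x-n)^\rho=\frac{\pi^{3/2}}{24\,\Gamma\left(\rho+\frac52\right)}x^{\rho+\frac32}+O(x^{\rho+1+\epsilon}).$$
   Context: Hurwitz class numbers: for a discriminant $d<0$ let $\mathcal Q_d$ be the set of integral binary quadratic forms of discriminant $d$ which are not negative definite; for $n>0$, $H(n)=\sum_{Q\in\mathrm{SL}_2(\mathbb Z)\backslash\mathcal Q_{-n}}\frac{2}{|\mathrm{Stab}(Q)|}$ (stabilizer in $\mathrm{SL}_2(\mathbb Z)$), with $H(n)=0$ if $-n$ is neither zero nor a negative discriminant, and $H(0)=-\frac1{12}$. The sum is over positive integers $n\le x$ (including $n=0$ would not affect the statement). The implied constant may depend on $\rho$ and $\epsilon$. *)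

theory Defs
  imports "HOL-Analysis.Analysis" "HOL-Library.Landau_Symbols"
begin

text \<open>The triple \<open>(a, b, c)\<close> encodes the integral binary quadratic form
  \<open>a x^2 + b x y + c y^2\<close>.\<close>

type_synonym bqf = "int \<times> int \<times> int"

fun bqf_eval :: "bqf \<Rightarrow> int \<Rightarrow> int \<Rightarrow> int" where
  "bqf_eval (a, b, c) x y = a * x^2 + b * x * y + c * y^2"

fun bqf_disc :: "bqf \<Rightarrow> int" where
  "bqf_disc (a, b, c) = b^2 - 4 * a * c"

definition negative_definite :: "bqf \<Rightarrow> bool" where
  "negative_definite Q \<longleftrightarrow> (\<forall>x y. (x, y) \<noteq> (0, 0) \<longrightarrow> bqf_eval Q x y < 0)"

definition bqf_set :: "int \<Rightarrow> bqf set" where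
  "bqf_set d = {Q. bqf_disc Q = d \<and> \<not> negative_definite Q}"

definition SL2Z :: "(int^2^2) set" where
  "SL2Z = {M. det M = 1}"

text \<open>The (right) action by linear substitution of the variables, written out on coefficients;
  \<open>bqf_eval_act\<close> below says that it is \<open>Q \<mapsto> Q \<circ> M\<close>.\<close>

fun bqf_act :: "bqf \<Rightarrow> int^2^2 \<Rightarrow> bqf" where
  "bqf_act (a, b, c) M =
     (bqf_eval (a, b, c) (M$1$1) (M$2$1),
      2 * a * M$1$1 * M$1$2 + b * (M$1$1 * M$2$2 + M$1$2 * M$2$1) + 2 * c * M$2$1 * M$2$2,
      bqf_eval (a, b, c) (M$1$2) (M$2$2))"

lemma bqf_eval_act:
  "bqf_eval (bqf_act Q M) x y = bqf_eval Q (M$1$1 * x + M$1$2 * y) (M$2$1 * x + M$2$2 * y)"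
  by (cases Q) (simp add: algebra_simps power2_eq_square)

definition bqf_stab :: "bqf \<Rightarrow> (int^2^2) set" where
  "bqf_stab Q = {M \<in> SL2Z. bqf_act Q M = Q}"

definition bqf_equiv :: "int \<Rightarrow> (bqf \<times> bqf) set" where
  "bqf_equiv d = {(P, Q). P \<in> bqf_set d \<and> Q \<in> bqf_set d \<and> (\<exists>M\<in>SL2Z. bqf_act P M = Q)}"

definition bqf_classes :: "int \<Rightarrow> bqf set set" where
  "bqf_classes d = bqf_set d // bqf_equiv d"

definition is_discriminant :: "int \<Rightarrow> bool" where
  "is_discriminant d \<longleftrightarrow> d mod 4 \<in> {0, 1}"

text \<open>Stabilizers of equivalent forms are conjugate, so the summand does not depend on the
  representative picked by \<open>SOME\<close>.\<close>

definition hurwitz_class_number :: "int \<Rightarrow> real" where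
  "hurwitz_class_number n =
     (if n = 0 then - 1 / 12
      else if n > 0 \<and> is_discriminant (- n)
      then (\<Sum>C\<in>bqf_classes (- n). 2 / real (card (bqf_stab (SOME Q. Q \<in> C))))
      else 0)"

end

theory Submission
  imports Defs
begin

text \<open>Every class of forms of discriminant \<open>-n\<close> contains a form with \<open>\<bar>b\<bar> \<le> a \<le> c\<close>, while forms with
  \<open>\<bar>b\<bar> < a < c\<close> are pairwise inequivalent and have stabilizer \<open>{I, -I}\<close>. Hence \<open>H(n)\<close> lies between the
  numbers of strictly reduced and of reduced forms, and both numbers, summed over \<open>n \<le> x\<close>, count
  lattice points of a region of volume \<open>\<pi>/18 x^(3/2)\<close> up to an error \<open>O(x log x)\<close>. The Riesz mean is
  the integral of the partial sums \<open>S(t)\<close> of \<open>H\<close> against \<open>\<rho> (x - t)^(\<rho> - 1)\<close> over \<open>[0, x]\<close>: the main term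
  of \<open>S\<close> gives a Beta integral, and the error grows by the factor \<open>x^\<rho>\<close>.\<close>

section \<open>Reduction of definite binary quadratic forms\<close>

definition mat2 :: "int \<Rightarrow> int \<Rightarrow> int \<Rightarrow> int \<Rightarrow> int^2^2" where
  "mat2 p q r s = (\<chi> i j. if i = 1 then (if j = 1 then p else q) else (if j = 1 then r else s))"

lemma mat2_nth [simp]:
  "mat2 p q r s $ 1 $ 1 = p" "mat2 p q r s $ 1 $ 2 = q"
  "mat2 p q r s $ 2 $ 1 = r" "mat2 p q r s $ 2 $ 2 = s"
  by (simp_all add: mat2_def)

lemma mat2_eq_iff:
  "M = mat2 p q r s \<longleftrightarrow> M$1$1 = p \<and> M$1$2 = q \<and> M$2$1 = r \<and> M$2$2 = s"
  by (auto simp: vec_eq_iff forall_2)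

lemma mat_1_eq_mat2: "mat 1 = mat2 1 0 0 1"
  by (simp add: mat2_eq_iff mat_def)

lemma mult_nth_2:
  fixes M N :: "int^2^2"
  shows "(M ** N) $ i $ j = M$i$1 * N$1$j + M$i$2 * N$2$j"
  by (simp add: matrix_matrix_mult_def sum_2)

lemma SL2Z_iff: "M \<in> SL2Z \<longleftrightarrow> M$1$1 * M$2$2 - M$1$2 * M$2$1 = 1"
  by (simp add: SL2Z_def det_2)

lemma SL2Z_mult: "M \<in> SL2Z \<Longrightarrow> N \<in> SL2Z \<Longrightarrow> M ** N \<in> SL2Z"
  by (simp add: SL2Z_def det_mul)

lemma SL2Z_one: "mat 1 \<in> SL2Z"
  by (simp add: SL2Z_def)

lemma SL2Z_inverse:
  assumes "M \<in> SL2Z"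
  obtains N where "N \<in> SL2Z" "M ** N = mat 1" "N ** M = mat 1"
proof
  let ?N = "mat2 (M$2$2) (- M$1$2) (- M$2$1) (M$1$1)"
  show "?N \<in> SL2Z" "M ** ?N = mat 1" "?N ** M = mat 1"
    using assms by (simp_all add: SL2Z_iff mat_1_eq_mat2 mat2_eq_iff mult_nth_2 algebra_simps)
qed

lemma bqf_act_mult: "bqf_act Q (M ** N) = bqf_act (bqf_act Q M) N"
  by (cases Q) (simp add: mult_nth_2 algebra_simps power2_eq_square)

lemma bqf_act_one: "bqf_act Q (mat 1) = Q"
  by (cases Q) (simp add: mat_1_eq_mat2)

lemma bqf_disc_act:
  assumes "M \<in> SL2Z"
  shows "bqf_disc (bqf_act Q M) = bqf_disc Q"
proof -
  obtain a b c where Q: "Q = (a, b, c)" by (cases Q)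
  have "bqf_disc (bqf_act Q M) = (M$1$1 * M$2$2 - M$1$2 * M$2$1)^2 * bqf_disc Q"
    by (simp add: Q algebra_simps power2_eq_square)
  with assms show ?thesis by (simp add: SL2Z_iff)
qed

text \<open>Completing the square. The coefficient of \<open>y^2\<close> is minus the discriminant,
  so positivity can be read off.\<close>

lemma four_lead_coeff_bqf_eval:
  "4 * a * bqf_eval (a, b, c) x y = (2 * a * x + b * y)^2 + (4 * a * c - b^2) * y^2"
  by (simp add: algebra_simps power2_eq_square)

text \<open>The factor \<open>a\<close> treats both signs of the leading coefficient at once: away
  from the origin the form has the sign of \<open>a\<close>.\<close>

lemma definite_form_pos:
  assumes "4 * a * c - b^2 > 0" "(x, y) \<noteq> (0, 0)"
  shows "a * bqf_eval (a, b, c) x y > 0"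
proof (cases "y = 0")
  case True
  moreover have "a \<noteq> 0" using assms(1) by auto
  ultimately have "(a * x)^2 > 0" using assms(2) by simp
  then show ?thesis using True by (simp add: power2_eq_square algebra_simps)
next
  case False
  then have "(4 * a * c - b^2) * y^2 > 0" using assms(1) by simp
  then have "4 * a * bqf_eval (a, b, c) x y > 0"
    unfolding four_lead_coeff_bqf_eval by (simp add: add_nonneg_pos)
  then show ?thesis by simp
qed

text \<open>A form of negative discriminant is definite with the sign of \<open>a\<close>, so
  excluding the negative definite ones amounts to \<open>a > 0\<close>.\<close>

lemma bqf_set_neg_iff:
  assumes "n > 0"
  shows "(a, b, c) \<in> bqf_set (- n) \<longleftrightarrow> a > 0 \<and> 4 * a * c - b^2 = n"
proof (cases "4 * a * c - b^2 = n")
  case n: True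
  have pos: "a * bqf_eval (a, b, c) x y > 0" if "(x, y) \<noteq> (0, 0)" for x y
    using definite_form_pos[OF _ that] n assms by blast
  have "\<not> negative_definite (a, b, c) \<longleftrightarrow> a > 0"
  proof
    assume "a > 0"
    then have "bqf_eval (a, b, c) 1 0 > 0" by simp
    then show "\<not> negative_definite (a, b, c)"
      unfolding negative_definite_def by (metis order_less_asym prod.inject zero_neq_one)
  next
    assume "\<not> negative_definite (a, b, c)"
    then show "a > 0"
      unfolding negative_definite_def using pos by (meson not_less zero_less_mult_iff)
  qed
  with n show ?thesis by (auto simp: bqf_set_def)
qed (auto simp: bqf_set_def)

lemma bqf_act_in_bqf_set:
  assumes "n > 0" "Q \<in> bqf_set (- n)" "M \<in> SL2Z"
  shows "bqf_act Q M \<in> bqf_set (- n)"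
proof -
  obtain a b c where Q: "Q = (a, b, c)" by (cases Q)
  obtain a' b' c' where Q': "bqf_act Q M = (a', b', c')" by (cases "bqf_act Q M")
  have a: "a > 0" "4 * a * c - b^2 = n" using assms Q by (simp_all add: bqf_set_neg_iff)
  have "(M$1$1, M$2$1) \<noteq> (0, 0)" using assms(3) by (auto simp: SL2Z_iff)
  then have "a * bqf_eval (a, b, c) (M$1$1) (M$2$1) > 0"
    using definite_form_pos a assms(1) by blast
  moreover have "a' = bqf_eval (a, b, c) (M$1$1) (M$2$1)" using Q Q' by simp
  ultimately have "a' > 0" using a by (simp add: zero_less_mult_iff)
  moreover have "bqf_disc (a', b', c') = bqf_disc (a, b, c)"
    using bqf_disc_act[OF assms(3), of Q] Q Q' by metis
  ultimately show ?thesis using a assms(1) by (simp add: Q' bqf_set_neg_iff)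
qed

lemma equiv_bqf_equiv:
  assumes "n > 0"
  shows "equiv (bqf_set (- n)) (bqf_equiv (- n))"
proof (rule equivI)
  show "bqf_equiv (- n) \<subseteq> bqf_set (- n) \<times> bqf_set (- n)"
    by (auto simp: bqf_equiv_def)
  show "refl_on (bqf_set (- n)) (bqf_equiv (- n))"
    using SL2Z_one bqf_act_one by (fastforce simp: refl_on_def bqf_equiv_def)
  show "sym (bqf_equiv (- n))"
  proof (rule symI)
    fix P Q assume "(P, Q) \<in> bqf_equiv (- n)"
    then obtain M where M: "P \<in> bqf_set (- n)" "Q \<in> bqf_set (- n)" "M \<in> SL2Z" "bqf_act P M = Q"
      by (auto simp: bqf_equiv_def)
    obtain N where "N \<in> SL2Z" "M ** N = mat 1" using SL2Z_inverse[OF M(3)] by metis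
    then show "(Q, P) \<in> bqf_equiv (- n)"
      using M bqf_act_mult[of P M N] bqf_act_one[of P] by (auto simp: bqf_equiv_def)
  qed
  show "trans (bqf_equiv (- n))"
  proof (rule transI)
    fix P Q R assume "(P, Q) \<in> bqf_equiv (- n)" "(Q, R) \<in> bqf_equiv (- n)"
    then show "(P, R) \<in> bqf_equiv (- n)"
      unfolding bqf_equiv_def using SL2Z_mult bqf_act_mult by (smt (verit) case_prodD case_prodI mem_Collect_eq)
  qed
qed

section \<open>Reduced forms: finiteness, existence and uniqueness\<close>

definition reduced_forms :: "int \<Rightarrow> bqf set" where
  "reduced_forms n = {(a, b, c). 4 * a * c - b^2 = n \<and> \<bar>b\<bar> \<le> a \<and> a \<le> c}"

text \<open>The interior of the reduction domain. Equivalences between distinct reduced forms and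
  larger stabilizers occur only on the boundary, which is dropped here and kept whole in
  \<open>reduced_forms\<close>; an upper and a lower bound thus replace any tie-breaking
  convention.\<close>

definition strictly_reduced_forms :: "int \<Rightarrow> bqf set" where
  "strictly_reduced_forms n = {(a, b, c). 4 * a * c - b^2 = n \<and> \<bar>b\<bar> < a \<and> a < c}"

text \<open>From \<open>b^2 \<le> a^2 \<le> a * c\<close>. It bounds all coefficients in terms of
  \<open>n\<close>, and also gives \<open>a^2 \<le> n\<close> and the sign of the discriminant later
  on.\<close>

lemma reduced_form_bound:
  fixes a b c :: int
  assumes "\<bar>b\<bar> \<le> a" "a \<le> c"
  shows "3 * a * c \<le> 4 * a * c - b^2"
proof -
  have "b^2 \<le> a * a" using assms(1) by (metis abs_ge_zero abs_le_square_iff abs_of_nonneg order_trans power2_eq_square)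
  also have "\<dots> \<le> a * c" using assms by (intro mult_left_mono) auto
  finally show ?thesis by simp
qed

lemma reduced_forms_subset:
  assumes "n > 0"
  shows "reduced_forms n \<subseteq> {1..n} \<times> {-n..n} \<times> {1..n}"
proof (clarsimp simp: reduced_forms_def)
  fix a b c :: int
  assume n: "n = 4 * a * c - b^2" and r: "\<bar>b\<bar> \<le> a" "a \<le> c"
  have "a \<noteq> 0" using n r assms by auto
  then have a: "a \<ge> 1" using r by linarith
  have "c \<le> a * c" using a r by (simp add: mult_le_cancel_right1)
  then have "c \<le> n" using reduced_form_bound[OF r] n a r by linarith
  then show "1 \<le> a \<and> a \<le> 4 * a * c - b\<^sup>2 \<and> b\<^sup>2 - 4 * a * c \<le> b \<and> b \<le> 4 * a * c - b\<^sup>2 \<and>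
     1 \<le> c \<and> c \<le> 4 * a * c - b\<^sup>2"
    using a r n by auto
qed

lemma finite_reduced_forms: "n > 0 \<Longrightarrow> finite (reduced_forms n)"
  using reduced_forms_subset by (rule finite_subset) auto

lemma reduced_subset: "n > 0 \<Longrightarrow> reduced_forms n \<subseteq> bqf_set (- n)"
  using reduced_forms_subset[of n] bqf_set_neg_iff[of n] by (fastforce simp: reduced_forms_def)

lemma strictly_reduced_subset: "n > 0 \<Longrightarrow> strictly_reduced_forms n \<subseteq> bqf_set (- n)"
  using reduced_subset[of n] by (force simp: strictly_reduced_forms_def reduced_forms_def)

text \<open>A form with minimal leading coefficient in its class becomes reduced after a translation.\<close>

lemma exists_reduced:
  assumes n: "n > 0" and Q: "Q \<in> bqf_set (- n)"
  shows "\<exists>M\<in>SL2Z. bqf_act Q M \<in> reduced_forms n"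
proof -
  let ?P = "\<lambda>M. M \<in> SL2Z"
  let ?f = "\<lambda>M. nat (fst (bqf_act Q M))"
  obtain M where M: "M \<in> SL2Z" and min: "\<And>N. N \<in> SL2Z \<Longrightarrow> ?f M \<le> ?f N"
    using ex_has_least_nat[of ?P "mat 1" ?f] SL2Z_one by blast
  obtain a b c where abc: "bqf_act Q M = (a, b, c)" by (cases "bqf_act Q M")
  have a: "a > 0" "4 * a * c - b^2 = n"
    using bqf_act_in_bqf_set[OF n Q M] n by (simp_all add: abc bqf_set_neg_iff)
  \<comment> \<open>The translation by \<open>k\<close> moves the middle coefficient to
    \<open>(b + a) mod (2 * a) - a\<close>, which lies between \<open>-a\<close> and
    \<open>a\<close>.\<close>
  define k where "k = - ((b + a) div (2 * a))"
  define T where "T = mat2 1 k 0 1"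
  define b' where "b' = b + 2 * a * k"
  define c' where "c' = a * k^2 + b * k + c"
  have T: "T \<in> SL2Z" by (simp add: T_def SL2Z_iff)
  have act: "bqf_act Q (M ** T) = (a, b', c')"
    unfolding bqf_act_mult abc by (simp add: T_def b'_def c'_def algebra_simps)
  have "b' + a = (b + a) mod (2 * a)"
    unfolding b'_def k_def by (simp add: minus_mult_div_eq_mod [symmetric])
  then have "\<bar>b'\<bar> \<le> a"
    using pos_mod_bound[of "2 * a" "b + a"] pos_mod_sign[of "2 * a" "b + a"] a by linarith
  moreover have "4 * a * c' - b'^2 = n"
    using bqf_act_in_bqf_set[OF n Q SL2Z_mult[OF M T]] n by (simp add: act bqf_set_neg_iff)
  moreover have "a \<le> c'"
  proof -
    \<comment> \<open>\<open>S\<close> swaps the outer coefficients, so \<open>c'\<close> is also a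
      leading coefficient in the class and minimality of \<open>a\<close> applies to it.\<close>
    define S where "S = mat2 0 (-1) 1 0"
    have S: "S \<in> SL2Z" by (simp add: S_def SL2Z_iff)
    have "bqf_act Q ((M ** T) ** S) = (c', - b', a)"
      unfolding bqf_act_mult[of Q "M ** T"] act by (simp add: S_def)
    then have "nat a \<le> nat c'" using min[OF SL2Z_mult[OF SL2Z_mult[OF M T] S]] abc by simp
    then show ?thesis using a by linarith
  qed
  ultimately have "bqf_act Q (M ** T) \<in> reduced_forms n"
    by (simp add: act reduced_forms_def)
  then show ?thesis using SL2Z_mult[OF M T] by blast
qed

text \<open>The cross term is at most \<open>\<bar>b\<bar> * u * v\<close>. If
  \<open>u \<ge> v\<close>, the term \<open>a * u^2\<close> absorbs it and
  \<open>c * v^2 > a\<close> remains; if \<open>0 < u < v\<close>, the term \<open>c * v^2\<close>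
  absorbs it with room to spare and \<open>a * u^2 \<ge> a\<close> remains.\<close>

lemma strictly_reduced_eval_gt:
  assumes r: "\<bar>b\<bar> < a" "a < c" and y: "y \<noteq> 0"
  shows "bqf_eval (a, b, c) x y > a"
proof -
  define u v where "u = \<bar>x\<bar>" and "v = \<bar>y\<bar>"
  have uv: "u \<ge> 0" "v \<ge> 1" using y by (auto simp: u_def v_def)
  have c0: "c > 0" using r by linarith
  have v2: "v^2 \<ge> 1" using uv by (simp add: one_le_power)
  have "bqf_eval (a, b, c) x y = a * u^2 + b * x * y + c * v^2"
    by (simp add: u_def v_def)
  moreover have "b * x * y \<ge> - (\<bar>b\<bar> * u * v)"
    unfolding u_def v_def using abs_ge_minus_self[of "b * x * y"] by (simp add: abs_mult)
  moreover have "a * u^2 - \<bar>b\<bar> * u * v + c * v^2 > a"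
  proof (cases "u \<ge> v")
    case True
    have "\<bar>b\<bar> * u * v \<le> a * u * u"
      using True r uv by (intro mult_mono) auto
    moreover have "c \<le> c * v^2" using c0 v2 by (simp add: mult_le_cancel_left1)
    ultimately show ?thesis using r by (simp add: power2_eq_square algebra_simps)
  next
    case False
    show ?thesis
    proof (cases "u = 0")
      case True
      moreover have "c \<le> c * v^2" using c0 v2 by (simp add: mult_le_cancel_left1)
      ultimately show ?thesis using r by simp
    next
      case u: False
      have "\<bar>b\<bar> * u * v \<le> \<bar>b\<bar> * v * v"
        using False uv by (intro mult_mono) auto
      also have "\<dots> < c * v * v" using uv r by simp
      finally have "\<bar>b\<bar> * u * v < c * v^2" by (simp add: power2_eq_square mult.assoc)
      moreover have "u^2 \<ge> 1" using u uv by (simp add: int_one_le_iff_zero_less)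
      then have "a \<le> a * u^2" using r by (simp add: mult_le_cancel_left1)
      ultimately show ?thesis by linarith
    qed
  qed
  ultimately show ?thesis by linarith
qed

text \<open>The inverse of \<open>M\<close> yields \<open>a' \<le> a\<close>, so by the previous
  lemma the first column of \<open>M\<close> is \<open>(1, 0)\<close> up to sign and
  \<open>M\<close> is a translation up to sign. It changes \<open>b\<close> by a multiple of
  \<open>2 * a\<close>, while \<open>b\<close> and \<open>b'\<close> both lie strictly between
  \<open>-a\<close> and \<open>a\<close>. This settles inequivalence and stabilizers
  together.\<close>

lemma strictly_reduced_unique:
  assumes P: "P \<in> strictly_reduced_forms n" and Q: "bqf_act P M \<in> strictly_reduced_forms n"
    and M: "M \<in> SL2Z"
  shows "bqf_act P M = P \<and> M \<in> {mat2 1 0 0 1, mat2 (-1) 0 0 (-1)}"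
proof -
  obtain a b c where abc: "P = (a, b, c)" by (cases P)
  obtain a' b' c' where abc': "bqf_act P M = (a', b', c')" by (cases "bqf_act P M")
  have r: "\<bar>b\<bar> < a" "a < c" and r': "\<bar>b'\<bar> < a'" "a' < c'"
    using P Q abc abc' by (auto simp: strictly_reduced_forms_def)
  have a': "a' = bqf_eval (a, b, c) (M$1$1) (M$2$1)"
    and b': "b' = 2 * a * M$1$1 * M$1$2 + b * (M$1$1 * M$2$2 + M$1$2 * M$2$1) + 2 * c * M$2$1 * M$2$2"
    using abc abc' by auto
  obtain N where N: "N \<in> SL2Z" "M ** N = mat 1" using SL2Z_inverse[OF M] by metis
  have "bqf_act (a', b', c') N = (a, b, c)"
    using bqf_act_mult[of P M N] N(2) abc abc' bqf_act_one by metis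
  then have a: "a = bqf_eval (a', b', c') (N$1$1) (N$2$1)" by auto
  have "a' \<le> a"
  proof (cases "N$2$1 = 0")
    case True
    then have "N$1$1 \<noteq> 0" using N(1) by (auto simp: SL2Z_iff)
    then have "(N$1$1)^2 \<ge> 1" by (simp add: int_one_le_iff_zero_less)
    then show ?thesis using a True r' by (simp add: mult_le_cancel_left1)
  qed (use strictly_reduced_eval_gt[OF r', of "N$2$1" "N$1$1"] a in linarith)
  then have m21: "M$2$1 = 0" using strictly_reduced_eval_gt[OF r, of "M$2$1" "M$1$1"] a' by force
  then have m: "M$1$1 * M$2$2 = 1" using M by (simp add: SL2Z_iff)
  then have m1: "M$1$1 = 1 \<and> M$2$2 = 1 \<or> M$1$1 = -1 \<and> M$2$2 = -1"
    by (simp add: zmult_eq_1_iff)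
  then have aa: "a' = a" using a' m21 by auto
  have "\<bar>b' - b\<bar> = 2 * a * \<bar>M$1$2\<bar>" using b' m21 m1 r by (auto simp: abs_mult)
  moreover have "\<bar>b' - b\<bar> < 2 * a" using r r' aa by linarith
  ultimately have "a * \<bar>M$1$2\<bar> < a * 1" by linarith
  then have m12: "M$1$2 = 0" using r by (subst (asm) mult_less_cancel_left_pos) auto
  from m21 m1 m12 have "M \<in> {mat2 1 0 0 1, mat2 (-1) 0 0 (-1)}"
    by (auto simp: mat2_eq_iff)
  moreover from this have "bqf_act P M = P" by (auto simp: abc)
  ultimately show ?thesis by blast
qed

section \<open>Stabilizers and the comparison of class numbers with counts of reduced forms\<close>

lemma pm_one_in_stab: "{mat2 1 0 0 1, mat2 (-1) 0 0 (-1)} \<subseteq> bqf_stab Q"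
  by (cases Q) (auto simp: bqf_stab_def SL2Z_iff)

lemma card_pm_one: "card {mat2 1 0 0 1, mat2 (-1) 0 0 (-1)} = 2"
proof -
  have "mat2 1 0 0 1 \<noteq> mat2 (-1) 0 0 (-1)" by (simp add: mat2_eq_iff)
  then show ?thesis by simp
qed

text \<open>Stated for every form equivalent to \<open>P\<close>, because \<open>SOME\<close> may
  pick any representative. Conjugation by \<open>M\<close> carries its stabilizer into that of
  \<open>P\<close>.\<close>

lemma stab_strictly_reduced:
  assumes P: "P \<in> strictly_reduced_forms n" and M: "M \<in> SL2Z"
  shows "card (bqf_stab (bqf_act P M)) = 2"
proof -
  obtain N where N: "N \<in> SL2Z" "M ** N = mat 1" "N ** M = mat 1" using SL2Z_inverse[OF M] by metis
  have "bqf_stab (bqf_act P M) \<subseteq> {mat2 1 0 0 1, mat2 (-1) 0 0 (-1)}"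
  proof
    fix A assume "A \<in> bqf_stab (bqf_act P M)"
    then have A: "A \<in> SL2Z" "bqf_act (bqf_act P M) A = bqf_act P M" by (auto simp: bqf_stab_def)
    let ?B = "M ** A ** N"
    have "bqf_act P ?B = P"
      using A(2) N by (metis bqf_act_mult bqf_act_one)
    then have "?B \<in> {mat2 1 0 0 1, mat2 (-1) 0 0 (-1)}"
      using strictly_reduced_unique[of P n ?B] P SL2Z_mult M A N by auto
    moreover have "A = N ** ?B ** M"
      using N(3) by (metis matrix_mul_assoc matrix_mul_lid matrix_mul_rid)
    ultimately have "A = N ** mat2 1 0 0 1 ** M \<or> A = N ** mat2 (-1) 0 0 (-1) ** M" by auto
    moreover have "N ** mat2 1 0 0 1 ** M = mat2 1 0 0 1"
      using N(3) by (simp add: mat_1_eq_mat2[symmetric])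
    moreover have "N ** mat2 (-1) 0 0 (-1) ** M = mat2 (-1) 0 0 (-1)"
      using N(3) unfolding mat_1_eq_mat2 mat2_eq_iff mult_nth_2 by simp
    ultimately show "A \<in> {mat2 1 0 0 1, mat2 (-1) 0 0 (-1)}" by auto
  qed
  with pm_one_in_stab have "bqf_stab (bqf_act P M) = {mat2 1 0 0 1, mat2 (-1) 0 0 (-1)}"
    by blast
  then show ?thesis using card_pm_one by simp
qed

text \<open>Both signs of the identity always stabilize. An infinite stabilizer would have
  \<open>card\<close> 0 and weight \<open>2 / 0 = 0\<close>, which obeys the bound too.\<close>

lemma two_over_card_stab_le_1: "2 / real (card (bqf_stab Q)) \<le> 1"
proof (cases "finite (bqf_stab Q)")
  case True
  then have "2 \<le> card (bqf_stab Q)" using card_mono[OF _ pm_one_in_stab] card_pm_one by metis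
  then show ?thesis by simp
qed simp

text \<open>Removes the case distinction on discriminants: squares are 0 or 1 modulo 4, so otherwise
  there are no forms and the sum is empty.\<close>

lemma hurwitz_eq_sum_classes:
  assumes "n > 0"
  shows "hurwitz_class_number n
    = (\<Sum>C\<in>bqf_classes (- n). 2 / real (card (bqf_stab (SOME Q. Q \<in> C))))"
proof (cases "is_discriminant (- n)")
  case False
  have "bqf_set (- n) = {}"
  proof (rule ccontr)
    assume "bqf_set (- n) \<noteq> {}"
    then obtain a b c where "b^2 - 4 * a * c = - n" by (auto simp: bqf_set_def)
    then have "- n = b^2 + (- (a * c)) * 4" by simp
    then have "- n mod 4 = b^2 mod 4" by (simp only: mod_mult_self1)
    moreover have "b^2 mod 4 \<in> {0, 1}"
    proof (cases "even b")
      case True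
      then show ?thesis by (auto elim!: evenE simp: power2_eq_square)
    next
      case False
      then obtain k where "b = 2 * k + 1" by (rule oddE)
      then have "b^2 = 4 * (k^2 + k) + 1" by (simp add: power2_eq_square algebra_simps)
      then have "b^2 mod 4 = 1" by presburger
      then show ?thesis by simp
    qed
    ultimately show False using False by (simp add: is_discriminant_def)
  qed
  then show ?thesis using False assms by (simp add: hurwitz_class_number_def bqf_classes_def)
qed (use assms in \<open>simp add: hurwitz_class_number_def\<close>)

lemma bqf_classes_eq:
  assumes "n > 0"
  shows "bqf_classes (- n) = (\<lambda>P. bqf_equiv (- n) `` {P}) ` reduced_forms n"
proof
  show "bqf_classes (- n) \<subseteq> (\<lambda>P. bqf_equiv (- n) `` {P}) ` reduced_forms n"
  proof
    fix C assume "C \<in> bqf_classes (- n)"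
    then obtain Q where Q: "Q \<in> bqf_set (- n)" "C = bqf_equiv (- n) `` {Q}"
      unfolding bqf_classes_def by (rule quotientE)
    obtain M where M: "M \<in> SL2Z" "bqf_act Q M \<in> reduced_forms n"
      using exists_reduced[OF assms Q(1)] by blast
    then have "(Q, bqf_act Q M) \<in> bqf_equiv (- n)"
      using Q(1) reduced_subset[OF assms] by (auto simp: bqf_equiv_def)
    then have "C = bqf_equiv (- n) `` {bqf_act Q M}"
      using equiv_class_eq[OF equiv_bqf_equiv[OF assms]] Q by simp
    then show "C \<in> (\<lambda>P. bqf_equiv (- n) `` {P}) ` reduced_forms n" using M by blast
  qed
  show "(\<lambda>P. bqf_equiv (- n) `` {P}) ` reduced_forms n \<subseteq> bqf_classes (- n)"
    using reduced_subset[OF assms] by (auto simp: bqf_classes_def intro!: quotientI)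
qed

lemma hurwitz_le_card_reduced:
  assumes "n > 0"
  shows "hurwitz_class_number n \<le> card (reduced_forms n)"
proof -
  have "hurwitz_class_number n \<le> (\<Sum>C\<in>bqf_classes (- n). 1)"
    unfolding hurwitz_eq_sum_classes[OF assms] by (intro sum_mono two_over_card_stab_le_1)
  also have "\<dots> \<le> card (reduced_forms n)"
    unfolding bqf_classes_eq[OF assms] using card_image_le[OF finite_reduced_forms[OF assms]] by simp
  finally show ?thesis .
qed

text \<open>Strictly reduced forms lie in distinct classes of weight exactly 1, and the remaining
  classes contribute nonnegative weights.\<close>

lemma card_strictly_reduced_le_hurwitz:
  assumes "n > 0"
  shows "card (strictly_reduced_forms n) \<le> hurwitz_class_number n"
proof -
  let ?R = "bqf_equiv (- n)" and ?T = "strictly_reduced_forms n"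
  let ?w = "\<lambda>C. 2 / real (card (bqf_stab (SOME Q. Q \<in> C)))"
  have sub: "?T \<subseteq> reduced_forms n"
    by (auto simp: strictly_reduced_forms_def reduced_forms_def)
  have inj: "inj_on (\<lambda>P. ?R `` {P}) ?T"
  proof (rule inj_onI)
    fix P Q assume PQ: "P \<in> ?T" "Q \<in> ?T" "?R `` {P} = ?R `` {Q}"
    then have "(P, Q) \<in> ?R"
      using eq_equiv_class[OF _ equiv_bqf_equiv[OF assms]] strictly_reduced_subset[OF assms] by blast
    then obtain M where "M \<in> SL2Z" "bqf_act P M = Q" by (auto simp: bqf_equiv_def)
    then show "P = Q" using strictly_reduced_unique[of P n M] PQ(1,2) by metis
  qed
  have w: "?w (?R `` {P}) = 1" if P: "P \<in> ?T" for P
  proof -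
    have "P \<in> ?R `` {P}"
      using equiv_class_self[OF equiv_bqf_equiv[OF assms]] strictly_reduced_subset[OF assms] P by blast
    then have "(SOME Q. Q \<in> ?R `` {P}) \<in> ?R `` {P}" by (rule someI)
    moreover define S where "S = (SOME Q. Q \<in> ?R `` {P})"
    ultimately have "(P, S) \<in> ?R" by simp
    then obtain M where "M \<in> SL2Z" and "S = bqf_act P M"
      unfolding bqf_equiv_def by blast
    then have "card (bqf_stab S) = 2"
      using stab_strictly_reduced[OF P] by simp
    then show ?thesis unfolding S_def by simp
  qed
  have "real (card ?T) = (\<Sum>P\<in>?T. 1)" by simp
  also have "\<dots> = (\<Sum>P\<in>?T. ?w (?R `` {P}))" by (rule sum.cong[OF refl]) (rule w[symmetric])
  also have "\<dots> = (\<Sum>C\<in>(\<lambda>P. ?R `` {P}) ` ?T. ?w C)"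
    by (simp only: sum.reindex[OF inj] o_def)
  also have "\<dots> \<le> (\<Sum>C\<in>bqf_classes (- n). ?w C)"
    unfolding bqf_classes_eq[OF assms]
    by (rule sum_mono2) (use sub finite_reduced_forms[OF assms] in auto)
  finally show ?thesis by (simp add: hurwitz_eq_sum_classes[OF assms])
qed

section \<open>The volume of the fundamental region\<close>

lemma monotone_riemann_sum_bounds:
  fixes f :: "real \<Rightarrow> real"
  assumes h: "h > 0" and cont: "continuous_on {0..real n * h} f"
    and mono: "mono_on {0..real n * h} f"
  shows "h * (\<Sum>k<n. f (real k * h)) \<le> integral {0..real n * h} f"
    and "integral {0..real n * h} f \<le> h * (\<Sum>k<n. f (real (Suc k) * h))"
proof -
  have "h * (\<Sum>k<n. f (real k * h)) \<le> integral {0..real n * h} f \<and>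
      integral {0..real n * h} f \<le> h * (\<Sum>k<n. f (real (Suc k) * h))"
    using cont mono
  proof (induction n)
    case (Suc n)
    let ?u = "real n * h" and ?v = "real (Suc n) * h"
    have uv: "0 \<le> ?u" "?u \<le> ?v" "?v - ?u = h" using h by (auto simp: algebra_simps)
    have int: "f integrable_on {0..?v}" "f integrable_on {?u..?v}"
      using uv by (intro integrable_continuous_interval continuous_on_subset[OF Suc.prems(1)]; auto)+
    have IH: "h * (\<Sum>k<n. f (real k * h)) \<le> integral {0..?u} f"
        "integral {0..?u} f \<le> h * (\<Sum>k<n. f (real (Suc k) * h))"
      using Suc.IH continuous_on_subset[OF Suc.prems(1), of "{0..?u}"]
        mono_on_subset[OF Suc.prems(2), of "{0..?u}"] uv by auto
    have const: "integral {?u..?v} (\<lambda>_. c) = h * c" for c :: real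
      using uv by simp
    have "integral {?u..?v} (\<lambda>_. f ?u) \<le> integral {?u..?v} f"
      using int uv
      by (intro integral_le) (auto intro!: mono_onD[OF Suc.prems(2)] intro: order_trans[OF uv(1)])
    moreover have "integral {?u..?v} f \<le> integral {?u..?v} (\<lambda>_. f ?v)"
      using int uv
      by (intro integral_le) (auto intro!: mono_onD[OF Suc.prems(2)] intro: order_trans[OF uv(1)])
    moreover have "integral {0..?v} f = integral {0..?u} f + integral {?u..?v} f"
      using Henstock_Kurzweil_Integration.integral_combine[OF uv(1,2) int(1)] by simp
    ultimately show ?case using IH unfolding const sum.lessThan_Suc distrib_left by linarith
  qed simp
  then show "h * (\<Sum>k<n. f (real k * h)) \<le> integral {0..real n * h} f"
    and "integral {0..real n * h} f \<le> h * (\<Sum>k<n. f (real (Suc k) * h))" by auto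
qed

text \<open>Left and right sums enclose the integral, and their difference telescopes to the mesh
  times the total increase of \<open>f\<close>.\<close>

lemma monotone_riemann_sum_error:
  fixes f :: "real \<Rightarrow> real"
  assumes "h > 0" "continuous_on {0..real n * h} f" "mono_on {0..real n * h} f"
  shows "h * (\<Sum>k<n. f (real (Suc k) * h)) \<in>
    {integral {0..real n * h} f .. integral {0..real n * h} f + h * (f (real n * h) - f 0)}"
proof -
  have "(\<Sum>k<n. f (real (Suc k) * h)) = (\<Sum>k<n. f (real k * h)) + (f (real n * h) - f 0)"
    using sum_lessThan_telescope[of "\<lambda>k. f (real k * h)" n] by (simp add: sum_subtractf)
  then have "h * (\<Sum>k<n. f (real (Suc k) * h)) = h * (\<Sum>k<n. f (real k * h)) + h * (f (real n * h) - f 0)"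
    by (simp add: distrib_left)
  then show ?thesis using monotone_riemann_sum_bounds[OF assms] by simp
qed

text \<open>Writing \<open>b = a t\<close>, the condition \<open>a \<le> c \<le> (x + b^2) / (4 a)\<close> confines \<open>c\<close> to an
  interval of length \<open>slab x a t / a\<close>. In these coordinates the length is monotone in \<open>a\<close> and in
  \<open>\<bar>t\<bar>\<close>, so sums can be compared with integrals one variable at a time.\<close>

definition slab :: "real \<Rightarrow> real \<Rightarrow> real \<Rightarrow> real" where
  "slab x a t = max 0 (x / 4 - a^2 * (1 - t^2 / 4))"

lemma slab_nonneg: "slab x a t \<ge> 0"
  by (simp add: slab_def)

lemma slab_uminus: "slab x a (- t) = slab x a t"
  by (simp add: slab_def)

lemma slab_le:
  assumes "x \<ge> 0" "\<bar>t\<bar> \<le> 1"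
  shows "slab x a t \<le> x / 4"
proof -
  have "t^2 \<le> 1" using assms(2) by (simp add: abs_square_le_1)
  then have "a^2 * (1 - t^2 / 4) \<ge> 0" by (intro mult_nonneg_nonneg) auto
  then show ?thesis using assms unfolding slab_def by (intro max.boundedI) linarith+
qed

lemma continuous_on_slab: "continuous_on A (\<lambda>(a, t). slab x a t)"
  unfolding slab_def case_prod_beta by (intro continuous_intros) auto

lemma continuous_on_slab_right: "continuous_on A (slab x a)"
  unfolding slab_def by (intro continuous_intros) auto

lemma slab_mono_right:
  assumes "0 \<le> s" "s \<le> t"
  shows "slab x a s \<le> slab x a t"
proof -
  have "s^2 \<le> t^2" using assms by (rule power_mono[rotated])
  then have "a^2 * (1 - t^2 / 4) \<le> a^2 * (1 - s^2 / 4)" by (intro mult_left_mono) auto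
  then show ?thesis unfolding slab_def by (intro max.mono) auto
qed

lemma slab_antimono_left:
  assumes "0 \<le> a" "a \<le> b" "\<bar>t\<bar> \<le> 1"
  shows "slab x b t \<le> slab x a t"
proof -
  have "t^2 \<le> 1" using assms(3) by (simp add: abs_square_le_1)
  moreover have "a^2 \<le> b^2" using assms by (intro power_mono)
  ultimately have "a^2 * (1 - t^2 / 4) \<le> b^2 * (1 - t^2 / 4)" by (intro mult_right_mono) auto
  then show ?thesis unfolding slab_def by (intro max.mono) auto
qed

text \<open>The factor \<open>a\<close> from \<open>b = a t\<close> cancels the denominator of the
  length \<open>slab x a t / a\<close>, so this is half the area of the region at height
  \<open>a\<close>; the other half is \<open>t < 0\<close>.\<close>

definition slice :: "real \<Rightarrow> real \<Rightarrow> real" where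
  "slice x a = integral {0..1} (slab x a)"

text \<open>A right Riemann sum on the unit interval with mesh \<open>1 / a\<close>, for a function
  increasing by at most \<open>x / 4\<close>.\<close>

lemma slab_sum_bounds:
  assumes "x \<ge> 0" "a > 0"
  shows "(\<Sum>k<a. slab x (real a) (real (Suc k) / real a)) / real a
    \<in> {slice x (real a) .. slice x (real a) + x / (4 * real a)}"
proof -
  have "slab x (real a) 1 - slab x (real a) 0 \<le> x / 4"
    using slab_le[of x 1 "real a"] slab_nonneg[of x "real a" 0] assms by simp
  then have "(slab x (real a) 1 - slab x (real a) 0) / real a \<le> x / 4 / real a"
    by (intro divide_right_mono) auto
  moreover have "1 / real a * (\<Sum>k<a. slab x (real a) (real (Suc k) * (1 / real a))) \<in>
     {integral {0..real a * (1 / real a)} (slab x (real a)) ..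
      integral {0..real a * (1 / real a)} (slab x (real a))
        + 1 / real a * (slab x (real a) (real a * (1 / real a)) - slab x (real a) 0)}"
    using assms by (intro monotone_riemann_sum_error continuous_on_slab_right mono_onI slab_mono_right) auto
  ultimately show ?thesis using assms by (simp add: slice_def)
qed

lemma slice_antimono:
  assumes "0 \<le> a" "a \<le> b"
  shows "slice x b \<le> slice x a"
  unfolding slice_def
  using assms by (intro integral_le integrable_continuous_interval continuous_on_slab_right slab_antimono_left) auto

lemma slice_nonneg: "slice x a \<ge> 0"
  unfolding slice_def
  by (intro integral_nonneg integrable_continuous_interval continuous_on_slab_right slab_nonneg)

lemma slice_0: "x \<ge> 0 \<Longrightarrow> slice x 0 = x / 4"
  by (simp add: slice_def slab_def[abs_def])

lemma continuous_on_slice: "continuous_on A (slice x)"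
proof -
  have "continuous_on A (\<lambda>a. integral (cbox 0 1) (slab x a))"
    by (rule integral_continuous_on_param[OF continuous_on_slab])
  then show ?thesis by (simp add: slice_def[abs_def])
qed

text \<open>The Riemann sum estimate with mesh 1, applied to \<open>- slice x\<close> because
  \<open>slice x\<close> decreases; the total drop is at most
  \<open>slice x 0 = x / 4\<close>.\<close>

lemma slice_sum_bounds:
  assumes "x \<ge> 0"
  shows "(\<Sum>k<M. slice x (real (Suc k)))
    \<in> {integral {0..real M} (slice x) - x / 4 .. integral {0..real M} (slice x)}"
proof -
  have "1 * (\<Sum>k<M. - slice x (real (Suc k) * 1)) \<in>
    {integral {0..real M * 1} (\<lambda>a. - slice x a) ..
     integral {0..real M * 1} (\<lambda>a. - slice x a) + 1 * (- slice x (real M * 1) - - slice x 0)}"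
    by (intro monotone_riemann_sum_error continuous_on_minus continuous_on_slice mono_onI)
      (auto intro: slice_antimono)
  then show ?thesis using slice_0[OF assms] slice_nonneg[of x "real M"] by (simp add: sum_negf)
qed

text \<open>The parabola \<open>x / 4 - a^2 * k\<close> is positive up to its zero \<open>A\<close>,
  and \<open>slab\<close> vanishes beyond. As \<open>k \<ge> 1 / 4\<close> forces
  \<open>A \<le> sqrt x\<close>, the cut-off \<open>M\<close> does not affect the value.\<close>

lemma integral_slab_left:
  assumes x: "x > 0" and t: "\<bar>t\<bar> \<le> 1" and M: "M \<ge> sqrt x"
  shows "integral {0..M} (\<lambda>a. slab x a t) = x * sqrt x / 12 * (1 / sqrt (1 - t^2 / 4))"
proof -
  define k where "k = 1 - t^2 / 4"
  define A where "A = sqrt x / (2 * sqrt k)"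
  have "t^2 \<le> 1" using t by (simp add: abs_square_le_1)
  then have k: "k \<ge> 1 / 4" by (simp add: k_def)
  then have "sqrt k \<ge> 1 / 2" using real_le_rsqrt[of "1/2" k] by (simp add: power2_eq_square)
  then have "sqrt x * 1 \<le> sqrt x * (2 * sqrt k)" using x by (intro mult_left_mono) auto
  then have "A \<le> sqrt x" using k by (simp add: A_def divide_le_eq)
  then have A: "A > 0" "A \<le> M" using M x k by (auto simp: A_def)
  have A2: "A^2 * k = x / 4" using x k by (simp add: A_def power_divide power_mult_distrib)
  have "((\<lambda>a. x / 4 - a^2 * k) has_integral ((x / 4 * A - A^3 / 3 * k) - (x / 4 * 0 - 0^3 / 3 * k))) {0..A}"
    using A by (intro fundamental_theorem_of_calculus)
      (auto intro!: derivative_eq_intros simp flip: has_real_derivative_iff_has_vector_derivative)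
  moreover have "slab x a t = x / 4 - a^2 * k" if "a \<in> {0..A}" for a
  proof -
    have "a^2 \<le> A^2" using that by (intro power_mono) auto
    then have "a^2 * k \<le> A^2 * k" using k by (intro mult_right_mono) auto
    then show ?thesis using A2 by (simp add: slab_def k_def)
  qed
  ultimately have 1: "((\<lambda>a. slab x a t) has_integral (x / 4 * A - A^3 / 3 * k)) {0..A}"
    by (subst has_integral_cong) auto
  have "slab x a t = 0" if "a \<in> {A..M}" for a
  proof -
    have "A^2 \<le> a^2" using that A by (intro power_mono) auto
    then have "A^2 * k \<le> a^2 * k" using k by (intro mult_right_mono) auto
    then show ?thesis using A2 by (simp add: slab_def k_def)
  qed
  then have 2: "((\<lambda>a. slab x a t) has_integral 0) {A..M}"
    by (subst has_integral_cong[where g = "\<lambda>_. 0"]) auto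
  have "x / 4 * A - A^3 / 3 * k = A * (x / 4) - A * (A^2 * k) / 3" by (simp add: power3_eq_cube power2_eq_square algebra_simps)
  also have "\<dots> = x * sqrt x / 12 * (1 / sqrt k)" unfolding A2 by (simp add: A_def)
  finally show ?thesis
    using has_integral_combine[OF _ _ 1 2] A by (simp add: integral_unique k_def)
qed

text \<open>After exchanging the integrals, \<open>1 / sqrt (1 - t^2 / 4)\<close> integrates to
  \<open>2 * arcsin (1 / 2) = pi / 3\<close> over the unit interval, and \<open>1 / 12\<close> of
  this is \<open>pi / 36\<close>.\<close>

lemma integral_slice:
  assumes x: "x > 0" and M: "M \<ge> sqrt x"
  shows "integral {0..M} (slice x) = pi / 36 * (x * sqrt x)"
proof -
  have "integral {0..M} (slice x) = integral (cbox 0 M) (\<lambda>a. integral (cbox 0 1) (slab x a))"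
    by (simp add: slice_def[abs_def])
  also have "\<dots> = integral (cbox 0 1) (\<lambda>t. integral (cbox 0 M) (\<lambda>a. slab x a t))"
    by (rule integral_swap_continuous[OF continuous_on_slab])
  also have "\<dots> = integral {0..1} (\<lambda>t. x * sqrt x / 12 * (1 / sqrt (1 - t^2 / 4)))"
    unfolding box_real using assms by (intro integral_cong integral_slab_left) auto
  also have "\<dots> = x * sqrt x / 12 * (2 * arcsin (1 / 2) - 2 * arcsin (0 / 2))"
  proof (rule integral_unique, rule has_integral_mult_right, rule fundamental_theorem_of_calculus)
    fix t :: real assume t: "t \<in> {0..1}"
    have D: "((\<lambda>t. arcsin (t / 2)) has_real_derivative inverse (sqrt (1 - (t / 2)^2)) * (1 / 2))
        (at t within {0..1})"
      by (rule DERIV_chain2[OF DERIV_arcsin])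
        (use t in \<open>auto intro!: derivative_eq_intros\<close>)
    have "((\<lambda>t. 2 * arcsin (t / 2)) has_real_derivative 1 / sqrt (1 - t^2 / 4)) (at t within {0..1})"
      using DERIV_cmult[OF D, of 2] by (simp add: power_divide inverse_eq_divide)
    then show "((\<lambda>t. 2 * arcsin (t / 2)) has_vector_derivative 1 / sqrt (1 - t^2 / 4)) (at t within {0..1})"
      by (simp add: has_real_derivative_iff_has_vector_derivative)
  qed simp
  finally show ?thesis by simp
qed

section \<open>Sums over integer intervals and harmonic numbers\<close>

lemma sum_even_symmetric_interval:
  fixes g :: "int \<Rightarrow> real"
  assumes "\<And>b. g (- b) = g b"
  shows "(\<Sum>b\<in>{- int n..int n}. g b) = g 0 + 2 * (\<Sum>k<n. g (int (Suc k)))"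
proof (induction n)
  case (Suc n)
  have "{- int (Suc n)..int (Suc n)} = insert (- int (Suc n)) (insert (int (Suc n)) {- int n..int n})"
    by auto
  then show ?case using Suc assms[of "int (Suc n)"] by simp
qed simp

lemma sum_int_interval: "(\<Sum>a\<in>{1..int M}. g a) = (\<Sum>k<M. g (int (Suc k)))" for g :: "int \<Rightarrow> real"
proof (induction M)
  case (Suc M)
  have "{1..int (Suc M)} = insert (int (Suc M)) {1..int M}" by auto
  then show ?case using Suc by simp
qed simp

lemma harm_le_1_plus_ln:
  assumes "n > 0"
  shows "harm n \<le> (1 + ln (real n) :: real)"
  using euler_mascheroni_sequence_decreasing[of 1 n] assms by (simp add: harm_def)

section \<open>Counting reduced forms\<close>

text \<open>Undoes \<open>b = a t\<close>: the result is the length of the interval of real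
  \<open>c\<close> with \<open>a \<le> c \<le> (x + b^2) / (4 a)\<close>, or 0 if it is
  empty.\<close>

lemma slab_lattice:
  assumes "a > 0"
  shows "slab x (real_of_int a) (real_of_int b / real_of_int a) / real_of_int a
    = max 0 ((x + real_of_int (b^2)) / (4 * real_of_int a) - real_of_int a)"
proof -
  let ?a = "real_of_int a" and ?b = "real_of_int b"
  have "slab x ?a (?b / ?a) = max (?a * 0) (?a * ((x + ?b^2) / (4 * ?a) - ?a))"
    unfolding slab_def using assms by (intro arg_cong2[where f = max]) (simp_all add: field_simps power2_eq_square)
  also have "\<dots> = ?a * max 0 ((x + ?b^2) / (4 * ?a) - ?a)"
    using assms by (subst max_mult_distrib_left) auto
  finally show ?thesis using assms by simp
qed

lemma le_floor_iff_form_le: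
  assumes "a > 0"
  shows "c \<le> \<lfloor>(x + real_of_int (b^2)) / (4 * real_of_int a)\<rfloor> \<longleftrightarrow> real_of_int (4 * a * c - b^2) \<le> x"
  using assms by (simp add: le_floor_iff le_divide_eq algebra_simps)

text \<open>The approximate number of reduced forms with leading coefficient \<open>a\<close> and
  \<open>n \<le> x\<close>, each interval of \<open>c\<close> being replaced by its length.\<close>

definition slab_sum :: "real \<Rightarrow> nat \<Rightarrow> real" where
  "slab_sum x a = (\<Sum>b\<in>{- int a..int a}. slab x (real a) (real_of_int b / real a) / real a)"

lemma slab_sum_eq:
  "slab_sum x a = slab x (real a) 0 / real a
     + 2 * ((\<Sum>k<a. slab x (real a) (real (Suc k) / real a)) / real a)"
  unfolding slab_sum_def
  by (subst sum_even_symmetric_interval) (simp_all add: slab_uminus sum_divide_distrib)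

text \<open>The term \<open>b = 0\<close> adds at most \<open>x / (4 a)\<close> and the two halves
  \<open>b > 0\<close>, \<open>b < 0\<close> err by at most \<open>x / (4 a)\<close> each.\<close>

lemma slab_sum_slice:
  assumes "x \<ge> 0" "a > 0"
  shows "slab_sum x a \<in> {2 * slice x (real a) .. 2 * slice x (real a) + x / real a}"
proof -
  have "slab x (real a) 0 / real a \<in> {0..x / 4 / real a}"
    using divide_right_mono[OF slab_le[of x 0 "real a"], of "real a"] slab_nonneg[of x "real a" 0] assms
    by simp
  then show ?thesis using slab_sum_bounds[OF assms] unfolding slab_sum_eq by (auto simp: field_simps)
qed

text \<open>The errors \<open>x / a\<close> add up to \<open>x * harm M\<close>; the lower error
  \<open>x / 2\<close> is twice that of \<open>slice_sum_bounds\<close>.\<close>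

lemma slab_sum_total:
  assumes x: "x > 0" and M: "real M \<ge> sqrt x"
  shows "(\<Sum>k<M. slab_sum x (Suc k)) \<in>
    {pi / 18 * (x * sqrt x) - x / 2 .. pi / 18 * (x * sqrt x) + x * harm M}"
proof -
  have I: "(\<Sum>k<M. slice x (real (Suc k))) \<in>
    {pi / 36 * (x * sqrt x) - x / 4 .. pi / 36 * (x * sqrt x)}"
    using slice_sum_bounds[of x M] integral_slice[OF assms] x by simp
  have "(\<Sum>k<M. 2 * slice x (real (Suc k))) \<le> (\<Sum>k<M. slab_sum x (Suc k))"
    using slab_sum_slice[of x "Suc _"] x by (intro sum_mono) auto
  moreover have "(\<Sum>k<M. slab_sum x (Suc k)) \<le> (\<Sum>k<M. 2 * slice x (real (Suc k)) + x / real (Suc k))"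
    using slab_sum_slice[of x "Suc _"] x by (intro sum_mono) auto
  moreover have "(\<Sum>k<M. x / real (Suc k)) = x * harm M"
    by (simp add: harm_altdef sum_distrib_left divide_inverse)
  ultimately show ?thesis using I by (simp add: sum.distrib flip: sum_distrib_left)
qed

text \<open>The number of pairs \<open>(a, b)\<close> with \<open>1 \<le> a \<le> M\<close> and
  \<open>\<bar>b\<bar> \<le> a\<close>, each of which costs a rounding error of at most 1.\<close>

lemma sum_odd_numbers: "(\<Sum>k<M. 2 * real (Suc k) + 1) = real M * (real M + 2)"
  by (induction M) (simp_all add: algebra_simps)

text \<open>Reduced forms satisfy \<open>a^2 \<le> n \<le> x\<close>, so \<open>a \<le> M\<close>
  and all of them lie in \<open>U\<close>. An interval of length \<open>L\<close> contains at most
  \<open>L + 1\<close> integers.\<close>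

lemma card_reduced_total_le:
  assumes x: "x > 0" and M: "real M \<ge> sqrt x"
  shows "(\<Sum>n\<in>{1..\<lfloor>x\<rfloor>}. real (card (reduced_forms n)))
    \<le> (\<Sum>k<M. slab_sum x (Suc k)) + real M * (real M + 2)"
proof -
  define C where "C a b = {a..\<lfloor>(x + real_of_int (b^2)) / (4 * real_of_int a)\<rfloor>}" for a b :: int
  define U where "U = (SIGMA a:{1..int M}. SIGMA b:{- a..a}. C a b)"
  have fin: "finite (C a b)" for a b by (simp add: C_def)
  have "(\<Union>n\<in>{1..\<lfloor>x\<rfloor>}. reduced_forms n) \<subseteq> U"
  proof clarify
    fix n a b c assume n: "n \<in> {1..\<lfloor>x\<rfloor>}" and abc: "(a, b, c) \<in> reduced_forms n"
    then have r: "4 * a * c - b^2 = n" "\<bar>b\<bar> \<le> a" "a \<le> c" by (auto simp: reduced_forms_def)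
    have a: "a > 0" using reduced_forms_subset[of n] n abc by auto
    have nx: "real_of_int n \<le> x" using n by (simp add: le_floor_iff)
    have "a * a \<le> 3 * a * c" using a r by (simp add: mult_mono)
    then have "a^2 \<le> n" using reduced_form_bound[OF r(2,3)] r(1) by (simp add: power2_eq_square)
    then have "(real_of_int a)^2 \<le> x" using nx by (metis of_int_le_iff of_int_power order_trans)
    then have "real_of_int a \<le> real M" using M real_le_rsqrt order_trans by blast
    then have "a \<le> int M" by simp
    moreover have "c \<le> \<lfloor>(x + real_of_int (b^2)) / (4 * real_of_int a)\<rfloor>"
      using nx r(1) by (subst le_floor_iff_form_le[OF a]) simp
    ultimately show "(a, b, c) \<in> U" using a r by (auto simp: U_def C_def)
  qed
  moreover have "finite U" by (simp add: U_def fin finite_SigmaI)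
  ultimately have "card (\<Union>n\<in>{1..\<lfloor>x\<rfloor>}. reduced_forms n) \<le> card U" by (rule card_mono[rotated])
  moreover have "card (\<Union>n\<in>{1..\<lfloor>x\<rfloor>}. reduced_forms n) = (\<Sum>n\<in>{1..\<lfloor>x\<rfloor>}. card (reduced_forms n))"
  proof (rule card_UN_disjoint)
    show "\<forall>n\<in>{1..\<lfloor>x\<rfloor>}. finite (reduced_forms n)" using finite_reduced_forms by auto
  qed (auto simp: reduced_forms_def)
  ultimately have "(\<Sum>n\<in>{1..\<lfloor>x\<rfloor>}. real (card (reduced_forms n))) \<le> real (card U)"
    by (metis of_nat_le_iff of_nat_sum)
  also have "card U = (\<Sum>a\<in>{1..int M}. \<Sum>b\<in>{- a..a}. card (C a b))"
    by (simp add: U_def fin)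
  also have "real \<dots> = (\<Sum>a\<in>{1..int M}. \<Sum>b\<in>{- a..a}. real (card (C a b)))"
    by simp
  also have "\<dots> \<le> (\<Sum>a\<in>{1..int M}. \<Sum>b\<in>{- a..a}.
      slab x (real_of_int a) (real_of_int b / real_of_int a) / real_of_int a + 1)"
  proof (intro sum_mono)
    fix a b :: int assume "a \<in> {1..int M}"
    then have "a > 0" by simp
    then show "real (card (C a b)) \<le> slab x (real_of_int a) (real_of_int b / real_of_int a) / real_of_int a + 1"
      unfolding slab_lattice[OF \<open>a > 0\<close>] C_def card_atLeastAtMost_int
      using of_int_floor_le[of "(x + real_of_int (b^2)) / (4 * real_of_int a)"] by linarith
  qed
  also have "\<dots> = (\<Sum>k<M. slab_sum x (Suc k) + (2 * real (Suc k) + 1))"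
    unfolding sum_int_interval by (intro sum.cong refl) (simp add: slab_sum_def sum.distrib)
  also have "\<dots> = (\<Sum>k<M. slab_sum x (Suc k)) + real M * (real M + 2)"
    unfolding sum.distrib[of _ _ "{..<M}"] sum_odd_numbers by simp
  finally show ?thesis .
qed

text \<open>Here \<open>U\<close> consists of strictly reduced forms. Each interval contains at
  least its length minus 1 integers \<open>c > a\<close>, and leaving out \<open>b = a\<close> and
  \<open>b = - a\<close> costs at most \<open>x / (2 a)\<close>, generously counted as
  \<open>x / a\<close>.\<close>

lemma card_strictly_reduced_total_ge:
  assumes x: "x > 0"
  shows "(\<Sum>n\<in>{1..\<lfloor>x\<rfloor>}. real (card (strictly_reduced_forms n)))
    \<ge> (\<Sum>k<M. slab_sum x (Suc k)) - real M * (real M + 2) - x * harm M"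
proof -
  define C where "C a b = {a + 1..\<lfloor>(x + real_of_int (b^2)) / (4 * real_of_int a)\<rfloor>}" for a b :: int
  define U where "U = (SIGMA a:{1..int M}. SIGMA b:{- (a - 1)..a - 1}. C a b)"
  define g where "g a b = slab x (real_of_int a) (real_of_int b / real_of_int a) / real_of_int a" for a b
  have fin: "finite (C a b)" for a b by (simp add: C_def)
  have sub: "strictly_reduced_forms n \<subseteq> reduced_forms n" for n
    by (auto simp: strictly_reduced_forms_def reduced_forms_def)
  have finU: "finite (\<Union>n\<in>{1..\<lfloor>x\<rfloor>}. strictly_reduced_forms n)"
    by (auto intro!: finite_subset[OF sub] finite_reduced_forms)
  have "U \<subseteq> (\<Union>n\<in>{1..\<lfloor>x\<rfloor>}. strictly_reduced_forms n)"
  proof clarify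
    fix a b c assume "(a, b, c) \<in> U"
    then have r: "a > 0" "\<bar>b\<bar> < a" "a < c"
      and c: "c \<le> \<lfloor>(x + real_of_int (b^2)) / (4 * real_of_int a)\<rfloor>"
      by (auto simp: U_def C_def)
    have "real_of_int (4 * a * c - b^2) \<le> x" using c le_floor_iff_form_le[OF r(1)] by blast
    then have "4 * a * c - b^2 \<le> \<lfloor>x\<rfloor>" by (simp only: le_floor_iff)
    moreover have "a * c > 0" using r by simp
    then have "4 * a * c - b^2 \<ge> 1" using reduced_form_bound[of b a c] r by linarith
    ultimately show "(a, b, c) \<in> (\<Union>n\<in>{1..\<lfloor>x\<rfloor>}. strictly_reduced_forms n)"
      using r by (auto simp: strictly_reduced_forms_def)
  qed
  then have "card U \<le> card (\<Union>n\<in>{1..\<lfloor>x\<rfloor>}. strictly_reduced_forms n)" by (rule card_mono[OF finU])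
  moreover have "card (\<Union>n\<in>{1..\<lfloor>x\<rfloor>}. strictly_reduced_forms n)
      = (\<Sum>n\<in>{1..\<lfloor>x\<rfloor>}. card (strictly_reduced_forms n))"
  proof (rule card_UN_disjoint)
    show "\<forall>n\<in>{1..\<lfloor>x\<rfloor>}. finite (strictly_reduced_forms n)"
      using finite_subset[OF sub finite_reduced_forms] by auto
  qed (auto simp: strictly_reduced_forms_def)
  ultimately have U: "real (card U) \<le> (\<Sum>n\<in>{1..\<lfloor>x\<rfloor>}. real (card (strictly_reduced_forms n)))"
    by (metis of_nat_le_iff of_nat_sum)
  have "(\<Sum>k<M. slab_sum x (Suc k)) - real M * (real M + 2) - x * harm M
      \<le> (\<Sum>k<M. slab_sum x (Suc k) - (2 * real (Suc k) + 1) - x / real (Suc k))"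
    unfolding sum_subtractf sum_odd_numbers by (simp add: harm_altdef sum_distrib_left divide_inverse)
  also have "\<dots> \<le> (\<Sum>a\<in>{1..int M}. \<Sum>b\<in>{- (a - 1)..a - 1}. g a b - 1)"
    unfolding sum_int_interval
  proof (rule sum_mono)
    fix k
    have "{- int (Suc k)..int (Suc k)} = {- int (Suc k), int (Suc k)} \<union> {- int k..int k}" by auto
    then have "slab_sum x (Suc k) = (\<Sum>b\<in>{- int k..int k}. g (int (Suc k)) b)
      + g (int (Suc k)) (- int (Suc k)) + g (int (Suc k)) (int (Suc k))"
      by (simp add: slab_sum_def g_def)
    moreover have "g (int (Suc k)) b \<le> x / 4 / real (Suc k)" if "\<bar>b\<bar> \<le> int (Suc k)" for b
    proof -
      have "\<bar>real_of_int b\<bar> \<le> real (Suc k)" using that by linarith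
      then have "slab x (real (Suc k)) (real_of_int b / real (Suc k)) \<le> x / 4"
        using x by (intro slab_le) (auto simp: abs_divide)
      then show ?thesis unfolding g_def of_int_of_nat_eq by (intro divide_right_mono) auto
    qed
    from this[of "- int (Suc k)"] this[of "int (Suc k)"]
    have "g (int (Suc k)) (- int (Suc k)) \<le> x / real (Suc k) / 4"
      "g (int (Suc k)) (int (Suc k)) \<le> x / real (Suc k) / 4"
      by (simp_all add: mult.commute)
    moreover have "x / real (Suc k) \<ge> 0" using x by simp
    moreover have "(\<Sum>b\<in>{- (int (Suc k) - 1)..int (Suc k) - 1}. g (int (Suc k)) b - 1)
        = (\<Sum>b\<in>{- int k..int k}. g (int (Suc k)) b) - (2 * real k + 1)"
      by (simp add: sum_subtractf)
    moreover have "real (Suc k) = real k + 1" by simp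
    \<comment> \<open>The linear core in fresh variables: \<open>T\<close> is the sum over
      \<open>\<bar>b\<bar> < a\<close>, \<open>u\<close> and \<open>v\<close> are the two end terms,
      \<open>q\<close> is \<open>x / a\<close>, and \<open>s\<close> is \<open>a\<close>.\<close>
    moreover have "P - (2 * s + 1) - q \<le> Q"
      if "P = T + u + v" "u \<le> q / 4" "v \<le> q / 4" "q \<ge> 0" "Q = T - (2 * r + 1)" "s = r + 1"
      for P Q T q r s u v :: real
      using that by linarith
    ultimately show "slab_sum x (Suc k) - (2 * real (Suc k) + 1) - x / real (Suc k)
        \<le> (\<Sum>b\<in>{- (int (Suc k) - 1)..int (Suc k) - 1}. g (int (Suc k)) b - 1)"
      by blast
  qed
  also have "\<dots> \<le> (\<Sum>a\<in>{1..int M}. \<Sum>b\<in>{- (a - 1)..a - 1}. real (card (C a b)))"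
  proof (intro sum_mono)
    fix a b :: int assume "a \<in> {1..int M}"
    then have a: "a > 0" by simp
    show "g a b - 1 \<le> real (card (C a b))"
      unfolding g_def slab_lattice[OF a] C_def card_atLeastAtMost_int
      using floor_correct[of "(x + real_of_int (b^2)) / (4 * real_of_int a)"] by linarith
  qed
  also have "\<dots> = real (card U)" by (simp add: U_def fin)
  finally show ?thesis using U by linarith
qed

section \<open>Asymptotics of the partial sums of class numbers\<close>

lemma hurwitz_partial_sum:
  assumes x: "x > 0" and M: "real M \<ge> sqrt x"
  shows "\<bar>(\<Sum>n\<in>{1..\<lfloor>x\<rfloor>}. hurwitz_class_number n) - pi / 18 * (x * sqrt x)\<bar>
    \<le> x / 2 + x * harm M + real M * (real M + 2)"
proof -
  have "(\<Sum>n\<in>{1..\<lfloor>x\<rfloor>}. hurwitz_class_number n) \<le> (\<Sum>n\<in>{1..\<lfloor>x\<rfloor>}. real (card (reduced_forms n)))"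
    by (intro sum_mono hurwitz_le_card_reduced) auto
  moreover have "(\<Sum>n\<in>{1..\<lfloor>x\<rfloor>}. real (card (strictly_reduced_forms n))) \<le> (\<Sum>n\<in>{1..\<lfloor>x\<rfloor>}. hurwitz_class_number n)"
    by (intro sum_mono card_strictly_reduced_le_hurwitz) auto
  ultimately show ?thesis
    using card_reduced_total_le[OF assms] card_strictly_reduced_total_ge[OF x, of M] slab_sum_total[OF assms] x
    by (auto simp: abs_le_iff)
qed

text \<open>The logarithm is absorbed by \<open>ln y \<le> y powr \<epsilon> / \<epsilon>\<close>.
  The base \<open>1 + x\<close> makes the bound hold from \<open>x = 0\<close> on, as integration
  over the whole range requires.\<close>

lemma hurwitz_partial_sum_powr:
  assumes \<epsilon>: "\<epsilon> > 0"
  obtains K where "K > 0" "\<And>x. x \<ge> 0 \<Longrightarrow>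
    \<bar>(\<Sum>n\<in>{1..\<lfloor>x\<rfloor>}. hurwitz_class_number n) - pi / 18 * x powr (3/2)\<bar> \<le> K * (1 + x) powr (1 + \<epsilon>)"
proof
  \<comment> \<open>In 10, a 9 comes from \<open>x / 2 + 6 * y\<close> and a 1 from the constant in
    the bound for \<open>harm M\<close>; the rest comes from \<open>ln (2 * y)\<close>.\<close>
  define K where "K = 10 + 4 powr \<epsilon> / \<epsilon>"
  show "K > 0" using \<epsilon> by (simp add: K_def add_pos_pos)
  fix x :: real assume x: "x \<ge> 0"
  define M where "M = nat \<lceil>sqrt x\<rceil>"
  define y where "y = 1 + x"
  have y: "y \<ge> 1" using x by (simp add: y_def)
  show "\<bar>(\<Sum>n\<in>{1..\<lfloor>x\<rfloor>}. hurwitz_class_number n) - pi / 18 * x powr (3/2)\<bar> \<le> K * (1 + x) powr (1 + \<epsilon>)"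
  proof (cases "x = 0")
    case True
    then show ?thesis using \<open>K > 0\<close> by simp
  next
    case False
    then have x0: "x > 0" using x by simp
    have M: "real M \<ge> sqrt x" "real M \<le> sqrt x + 1" "M > 0"
      using x0 unfolding M_def by (auto simp: of_nat_nat)
    have "2 * sqrt x \<le> x + 1"
      using zero_le_power2[of "sqrt x - 1"] x0 by (simp add: power2_eq_square algebra_simps)
    then have sq: "sqrt x \<le> y" "sqrt x * sqrt x = x" using x0 by (auto simp: y_def)
    have "real M * (real M + 2) \<le> (sqrt x + 1) * (sqrt x + 1 + 2)" using M x by (intro mult_mono) auto
    also have "\<dots> \<le> 6 * y" using sq \<open>2 * sqrt x \<le> x + 1\<close> by (simp add: algebra_simps y_def)
    finally have 1: "real M * (real M + 2) \<le> 6 * y" .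
    have "harm M \<le> 1 + ln (real M)" using M by (intro harm_le_1_plus_ln) auto
    also have "ln (real M) \<le> ln (2 * y)" using M sq y by (subst ln_le_cancel_iff) auto
    also have "\<dots> \<le> (2 * y) powr \<epsilon> / \<epsilon>" using y \<epsilon> by (intro ln_powr_bound) auto
    also have "(2 * y) powr \<epsilon> = 2 powr \<epsilon> * y powr \<epsilon>" using y by (simp add: powr_mult)
    also have "1 + 2 powr \<epsilon> * y powr \<epsilon> / \<epsilon> \<le> y powr \<epsilon> + 4 powr \<epsilon> * y powr \<epsilon> / \<epsilon>"
      using y \<epsilon> by (intro add_mono divide_right_mono mult_right_mono powr_mono2 ge_one_powr_ge_zero) auto
    finally have h: "harm M \<le> y powr \<epsilon> + 4 powr \<epsilon> * y powr \<epsilon> / \<epsilon>" by simp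
    have "x * harm M \<le> y * (y powr \<epsilon> + 4 powr \<epsilon> * y powr \<epsilon> / \<epsilon>)"
      using h x harm_nonneg[of M] by (intro mult_mono) (auto simp: y_def)
    also have "\<dots> = (1 + 4 powr \<epsilon> / \<epsilon>) * (y * y powr \<epsilon>)" by (simp add: algebra_simps)
    finally have 2: "x * harm M \<le> (1 + 4 powr \<epsilon> / \<epsilon>) * (y * y powr \<epsilon>)" .
    have "y * 1 \<le> y * y powr \<epsilon>" using y \<epsilon> by (intro mult_left_mono ge_one_powr_ge_zero) auto
    moreover have "x / 2 + 6 * y \<le> 9 * y" using x by (simp add: y_def)
    ultimately have 3: "x / 2 + 6 * y \<le> 9 * (y * y powr \<epsilon>)" by linarith
    have "x powr (3/2) = x powr (1 + 1/2)" by simp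
    also have "\<dots> = x * sqrt x" using x0 by (subst powr_add) (simp add: powr_half_sqrt)
    finally have "\<bar>(\<Sum>n\<in>{1..\<lfloor>x\<rfloor>}. hurwitz_class_number n) - pi / 18 * x powr (3/2)\<bar>
        \<le> x / 2 + x * harm M + real M * (real M + 2)"
      using hurwitz_partial_sum[OF x0 M(1)] by simp
    also have "\<dots> \<le> K * (y * y powr \<epsilon>)" using 1 2 3 by (simp add: K_def algebra_simps)
    also have "y * y powr \<epsilon> = y powr (1 + \<epsilon>)" using y by (simp add: powr_add)
    finally show ?thesis by (simp add: y_def)
  qed
qed

section \<open>Riesz means\<close>

lemma has_integral_powr_diff:
  fixes u x \<rho> :: real
  assumes "\<rho> > 0" "u \<le> x"
  shows "((\<lambda>t. \<rho> * (x - t) powr (\<rho> - 1)) has_integral (x - u) powr \<rho>) {u..x}"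
proof -
  have "((\<lambda>t. \<rho> * (x - t) powr (\<rho> - 1)) has_integral (- ((x - x) powr \<rho>) - - ((x - u) powr \<rho>))) {u..x}"
  \<comment> \<open>For \<open>\<rho> < 1\<close> the integrand is unbounded near
    \<open>t = x\<close>, so the derivative is taken only in the open interval and the
    antiderivative is merely continuous at the ends.\<close>
  proof (rule fundamental_theorem_of_calculus_interior)
    show "continuous_on {u..x} (\<lambda>t. - ((x - t) powr \<rho>))"
      using assms by (intro continuous_intros continuous_on_powr') auto
    fix t assume "t \<in> {u<..<x}"
    then have "((\<lambda>t. - ((x - t) powr \<rho>)) has_real_derivative \<rho> * (x - t) powr (\<rho> - 1)) (at t)"
      by (auto intro!: derivative_eq_intros simp: powr_diff)
    then show "((\<lambda>t. - ((x - t) powr \<rho>)) has_vector_derivative \<rho> * (x - t) powr (\<rho> - 1)) (at t)"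
      by (simp add: has_real_derivative_iff_has_vector_derivative)
  qed (use assms in auto)
  then show ?thesis by simp
qed

text \<open>Abel summation: each \<open>(x - n) powr \<rho>\<close> is the integral of the kernel
  over \<open>{n..x}\<close>, and at \<open>t\<close> exactly the terms with
  \<open>n \<le> t\<close> are present.\<close>

lemma riesz_sum_has_integral:
  fixes w :: "int \<Rightarrow> real" and x \<rho> :: real
  assumes "\<rho> > 0"
  shows "((\<lambda>t. (\<Sum>n\<in>{1..\<lfloor>t\<rfloor>}. w n) * (\<rho> * (x - t) powr (\<rho> - 1)))
    has_integral (\<Sum>n\<in>{1..\<lfloor>x\<rfloor>}. w n * (x - of_int n) powr \<rho>)) {0..x}"
proof -
  let ?f = "\<lambda>t. \<rho> * (x - t) powr (\<rho> - 1)"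
  have "((\<lambda>t. \<Sum>n\<in>{1..\<lfloor>x\<rfloor>}. w n * (if t \<in> {of_int n..x} then ?f t else 0))
    has_integral (\<Sum>n\<in>{1..\<lfloor>x\<rfloor>}. w n * (x - of_int n) powr \<rho>)) {0..x}"
  proof (intro has_integral_sum has_integral_mult_right)
    fix n assume "n \<in> {1..\<lfloor>x\<rfloor>}"
    then have n: "1 \<le> n" "real_of_int n \<le> x" by (auto simp: le_floor_iff)
    have "{real_of_int n..x} \<subseteq> {0..x}" using n by auto
    then show "((\<lambda>t. if t \<in> {of_int n..x} then ?f t else 0) has_integral (x - of_int n) powr \<rho>) {0..x}"
      using has_integral_powr_diff[OF assms n(2)] by (simp only: has_integral_restrict)
  qed simp
  moreover have "(\<Sum>n\<in>{1..\<lfloor>x\<rfloor>}. w n * (if t \<in> {of_int n..x} then ?f t else 0))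
      = (\<Sum>n\<in>{1..\<lfloor>t\<rfloor>}. w n) * ?f t" if "t \<in> {0..x}" for t
  proof -
    have "\<lfloor>t\<rfloor> \<le> \<lfloor>x\<rfloor>" using that by (auto intro: floor_mono)
    then have "(\<Sum>n\<in>{1..\<lfloor>t\<rfloor>}. w n * ?f t)
        = (\<Sum>n\<in>{1..\<lfloor>x\<rfloor>}. w n * (if t \<in> {of_int n..x} then ?f t else 0))"
      using that by (intro sum.mono_neutral_cong_left) (auto simp: le_floor_iff)
    then show ?thesis by (simp only: sum_distrib_right)
  qed
  ultimately show ?thesis using has_integral_eq by (metis (no_types, lifting))
qed

text \<open>The substitution \<open>t = x s\<close> in the Beta integral.\<close>

lemma has_integral_Beta_scaled:
  fixes x a b :: real
  assumes x: "x > 0" and ab: "a > 0" "b > 0"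
  shows "((\<lambda>t. t powr (a - 1) * (x - t) powr (b - 1)) has_integral x powr (a + b - 1) * Beta a b) {0..x}"
proof -
  let ?g = "\<lambda>t. t powr (a - 1) * (1 - t) powr (b - 1)"
  have img: "(\<lambda>t. t / (1 / x)) ` {0..1} = {0..x}"
    using x image_mult_atLeastAtMost[of x 0 1] by (simp add: mult.commute image_def)
  have "((\<lambda>t. ?g (1 / x * t)) has_integral (1 / \<bar>1 / x\<bar>) *\<^sub>R Beta a b) ((\<lambda>t. t / (1 / x)) ` {0..1})"
    using has_integral_Beta_real[OF ab] x by (intro has_integral_stretch_real) auto
  then have "((\<lambda>t. ?g (t / x)) has_integral x * Beta a b) {0..x}"
    unfolding img using x by simp
  then have "((\<lambda>t. x powr (a + b - 2) * ?g (t / x)) has_integral x powr (a + b - 2) * (x * Beta a b)) {0..x}"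
    by (rule has_integral_mult_right)
  moreover have "x powr (a + b - 2) * ?g (t / x) = t powr (a - 1) * (x - t) powr (b - 1)" if "t \<in> {0..x}" for t
  proof -
    have "1 - t / x = (x - t) / x" using x by (simp add: field_simps)
    then have "?g (t / x) = t powr (a - 1) * (x - t) powr (b - 1) / (x powr (a - 1) * x powr (b - 1))"
      using x that by (simp add: powr_divide)
    also have "x powr (a - 1) * x powr (b - 1) = x powr (a + b - 2)"
      by (simp flip: powr_add)
    finally show ?thesis using x by simp
  qed
  moreover have "x powr (a + b - 2) * (x * Beta a b) = x powr (a + b - 1) * Beta a b"
  proof -
    have "x powr (a + b - 1) = x powr (a + b - 2) * x powr 1"
      unfolding powr_add[symmetric] by simp
    then show ?thesis using x by simp
  qed
  ultimately show ?thesis using has_integral_eq by (metis (no_types, lifting))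
qed

text \<open>\<open>Gamma (5/2) = 3/4 * sqrt pi\<close> turns \<open>pi / 18\<close> into
  \<open>pi * sqrt pi / 24\<close>, and \<open>Gamma (\<rho> + 1) = \<rho> * Gamma \<rho>\<close>
  cancels the remaining factors.\<close>

lemma riesz_constant:
  assumes "\<rho> > (0 :: real)"
  shows "1 / Gamma (\<rho> + 1) * (pi / 18 * (\<rho> * Beta (5/2) \<rho>)) = pi powr (3 / 2) / (24 * Gamma (\<rho> + 5 / 2))"
proof -
  have "Gamma (5/2 :: real) = Gamma (3/2 + 1)" by simp
  also have "\<dots> = 3/2 * Gamma (1/2 + 1)" by (subst Gamma_plus1) (auto dest: nonpos_Ints_nonpos)
  also have "\<dots> = 3/4 * sqrt pi"
    by (subst Gamma_plus1) (auto dest: nonpos_Ints_nonpos simp: Gamma_one_half_real)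
  finally have G: "Gamma (5/2 :: real) = 3/4 * sqrt pi" .
  have G1: "Gamma (\<rho> + 1) = \<rho> * Gamma \<rho>" using assms by (intro Gamma_plus1) auto
  have "Gamma \<rho> > 0" "Gamma (5/2 + \<rho>) > 0" using assms by (auto intro: Gamma_real_pos)
  moreover have "pi powr (3 / 2) = pi powr (1 + 1/2)" by simp
  then have "pi powr (3/2) = pi * sqrt pi" unfolding powr_add by (simp add: powr_half_sqrt)
  moreover have "1 / (\<rho> * g) * (pi / 18 * (\<rho> * (3/4 * s * g / h))) = pi * s / (24 * h)"
    if "g > 0" "h > 0" for g h s :: real
    using that assms by (simp add: field_simps)
  ultimately show ?thesis unfolding G1 Beta_def G by (metis add.commute)
qed

text \<open>The kernel is nonnegative with integral \<open>x powr \<rho>\<close> over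
  \<open>{0..x}\<close>, and the error bound for the partial sums is largest at \<open>t = x\<close>
  since \<open>\<beta> \<ge> 0\<close>.\<close>

lemma riesz_mean_error:
  fixes w :: "int \<Rightarrow> real" and \<rho> \<alpha> \<beta> c K x :: real
  assumes \<rho>: "\<rho> > 0" and \<alpha>: "\<alpha> > 0" and \<beta>: "\<beta> \<ge> 0" and K: "K \<ge> 0" and x: "x > 0"
    and bound: "\<And>t. t \<ge> 0 \<Longrightarrow> \<bar>(\<Sum>n\<in>{1..\<lfloor>t\<rfloor>}. w n) - c * t powr \<alpha>\<bar> \<le> K * (1 + t) powr \<beta>"
  shows "\<bar>(\<Sum>n\<in>{1..\<lfloor>x\<rfloor>}. w n * (x - of_int n) powr \<rho>) - c * (\<rho> * Beta (\<alpha> + 1) \<rho>) * x powr (\<rho> + \<alpha>)\<bar>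
    \<le> K * (1 + x) powr \<beta> * x powr \<rho>"
proof -
  let ?f = "\<lambda>t. \<rho> * (x - t) powr (\<rho> - 1)"
  let ?S = "\<lambda>t. \<Sum>n\<in>{1..\<lfloor>t\<rfloor>}. w n"
  let ?D = "(\<Sum>n\<in>{1..\<lfloor>x\<rfloor>}. w n * (x - of_int n) powr \<rho>) - c * \<rho> * (x powr (\<alpha> + \<rho>) * Beta (\<alpha> + 1) \<rho>)"
  have "((\<lambda>t. c * \<rho> * (t powr (\<alpha> + 1 - 1) * (x - t) powr (\<rho> - 1)))
      has_integral c * \<rho> * (x powr (\<alpha> + 1 + \<rho> - 1) * Beta (\<alpha> + 1) \<rho>)) {0..x}"
    using \<alpha> \<rho> x by (intro has_integral_mult_right has_integral_Beta_scaled) auto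
  then have "((\<lambda>t. ?S t * ?f t - c * \<rho> * (t powr \<alpha> * (x - t) powr (\<rho> - 1))) has_integral ?D) {0..x}"
    by (intro has_integral_diff riesz_sum_has_integral[OF \<rho>]) (simp add: algebra_simps)
  then have D: "((\<lambda>t. (?S t - c * t powr \<alpha>) * ?f t) has_integral ?D) {0..x}"
    by (simp add: algebra_simps)
  have E: "((\<lambda>t. K * (1 + x) powr \<beta> * ?f t) has_integral K * (1 + x) powr \<beta> * (x - 0) powr \<rho>) {0..x}"
    using \<rho> x by (intro has_integral_mult_right has_integral_powr_diff) auto
  have "norm ((?S t - c * t powr \<alpha>) * ?f t) \<le> K * (1 + x) powr \<beta> * ?f t" if "t \<in> {0..x}" for t
  proof -
    have "\<bar>?S t - c * t powr \<alpha>\<bar> \<le> K * (1 + t) powr \<beta>" using bound that by simp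
    also have "\<dots> \<le> K * (1 + x) powr \<beta>" using K \<beta> that by (intro mult_left_mono powr_mono2) auto
    finally have "\<bar>?S t - c * t powr \<alpha>\<bar> * ?f t \<le> K * (1 + x) powr \<beta> * ?f t"
      using \<rho> by (intro mult_right_mono) auto
    then show ?thesis using \<rho> by (simp add: abs_mult)
  qed
  then have "norm (integral {0..x} (\<lambda>t. (?S t - c * t powr \<alpha>) * ?f t)) \<le> integral {0..x} (\<lambda>t. K * (1 + x) powr \<beta> * ?f t)"
    using D E by (intro integral_norm_bound_integral) (auto simp: has_integral_iff)
  then have "\<bar>?D\<bar> \<le> K * (1 + x) powr \<beta> * (x - 0) powr \<rho>"
    unfolding integral_unique[OF D] integral_unique[OF E] by simp
  then show ?thesis by (simp add: algebra_simps)
qed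

theorem theorem6p4:
  fixes \<rho> \<epsilon> :: real
  assumes "\<rho> > 1" and "\<epsilon> > 0"
  shows "(\<lambda>x::real.
            1 / Gamma (\<rho> + 1) *
              (\<Sum>n\<in>{1..\<lfloor>x\<rfloor>}. hurwitz_class_number n * (x - of_int n) powr \<rho>)
            - pi powr (3 / 2) / (24 * Gamma (\<rho> + 5 / 2)) * x powr (\<rho> + 3 / 2))
         \<in> O[at_top](\<lambda>x. x powr (\<rho> + 1 + \<epsilon>))"
proof -
  let ?R = "\<lambda>x. \<Sum>n\<in>{1..\<lfloor>x\<rfloor>}. hurwitz_class_number n * (x - of_int n) powr \<rho>"
  let ?m = "pi / 18 * (\<rho> * Beta (5/2) \<rho>)"
  obtain K where K: "K > 0" and bound: "\<And>t. t \<ge> 0 \<Longrightarrow>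
      \<bar>(\<Sum>n\<in>{1..\<lfloor>t\<rfloor>}. hurwitz_class_number n) - pi / 18 * t powr (3/2)\<bar> \<le> K * (1 + t) powr (1 + \<epsilon>)"
    using hurwitz_partial_sum_powr[OF assms(2)] by blast
  have error: "\<bar>?R x - ?m * x powr (\<rho> + 3/2)\<bar> \<le> K * 2 powr (1 + \<epsilon>) * x powr (\<rho> + 1 + \<epsilon>)" if x: "x \<ge> 1" for x
  proof -
    have "\<bar>?R x - pi / 18 * (\<rho> * Beta (3/2 + 1) \<rho>) * x powr (\<rho> + 3/2)\<bar> \<le> K * (1 + x) powr (1 + \<epsilon>) * x powr \<rho>"
      using assms K x bound by (intro riesz_mean_error) auto
    \<comment> \<open>\<open>1 + x \<le> 2 * x\<close> because \<open>x \<ge> 1\<close>; this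
      produces the constant \<open>2 powr (1 + \<epsilon>)\<close>.\<close>
    also have "\<dots> \<le> K * (2 * x) powr (1 + \<epsilon>) * x powr \<rho>"
      using assms K x by (intro mult_right_mono mult_left_mono powr_mono2) auto
    also have "\<dots> = K * 2 powr (1 + \<epsilon>) * (x powr (1 + \<epsilon>) * x powr \<rho>)"
      using x by (simp add: powr_mult)
    also have "x powr (1 + \<epsilon>) * x powr \<rho> = x powr (\<rho> + 1 + \<epsilon>)"
      unfolding powr_add[symmetric] by (simp add: add_ac)
    finally show ?thesis by simp
  qed
  have "(\<lambda>x. ?R x - ?m * x powr (\<rho> + 3/2)) \<in> O[at_top](\<lambda>x. x powr (\<rho> + 1 + \<epsilon>))"
    by (rule bigoI[where c = "K * 2 powr (1 + \<epsilon>)"])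
      (use eventually_ge_at_top[of 1] in \<open>eventually_elim, use error in auto\<close>)
  moreover have "Gamma (\<rho> + 1) > 0" using assms(1) by (intro Gamma_real_pos) simp
  then have G: "1 / Gamma (\<rho> + 1) \<noteq> 0" by (metis divide_eq_0_iff less_irrefl zero_neq_one)
  ultimately have "(\<lambda>x. 1 / Gamma (\<rho> + 1) * (?R x - ?m * x powr (\<rho> + 3/2))) \<in> O[at_top](\<lambda>x. x powr (\<rho> + 1 + \<epsilon>))"
    using G by (subst landau_o.big.cmult_in_iff) auto
  moreover have "1 / Gamma (\<rho> + 1) * (?R x - ?m * x powr (\<rho> + 3/2))
      = 1 / Gamma (\<rho> + 1) * ?R x - pi powr (3 / 2) / (24 * Gamma (\<rho> + 5 / 2)) * x powr (\<rho> + 3 / 2)" for x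
    unfolding riesz_constant[of \<rho>, symmetric, OF less_trans[OF zero_less_one assms(1)]]
    by (simp only: right_diff_distrib mult.assoc)
  ultimately show ?thesis by simp
qed

end
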